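(* Let $X$ be a real Banach space with dual $X^\ast$ and let $f\colon X\to\left]-\infty,+\infty\right]$ be proper, lower semicontinuous and convex. Then $$\mathcal{D}_{f\oplus f^\ast}^{\flat}(x,y)=\mathcal{D}_f^{\flat}(x,y)\quad\text{and}\quad \mathcal{D}_{f\oplus f^\ast}^{\sharp}(x,y)=\mathcal{D}_f^{\sharp}(x,y)$$ for all $(x,y)\in X\times X$ with $(x,y)\notin(\operatorname{dom} f\setminus\operatorname{dom}\partial f)\times\operatorname{dom}\partial f$.
   Context: $\partial f\colon X\rightrightarrows X^\ast$ is the convex subdifferential ($\partial f(x)=\varnothing$ if $x\notin\operatorname{dom} f$), $\operatorname{dom}\partial f=\{x:\partial f(x)\neq\varnothing\}$, $\operatorname{dom} f=\{x: f(x)<\infty\}$, and $f^\ast(v)=\sup_{x\in X}\{\langle x,v\rangle-f(x)\}$ is the Fenchel conjugate on $X^\ast$. Fenchel--Young representative: $(f\oplus f^\ast)(x,v):=f(x)+f^\ast(v)$ for $(x,v)\in X\times X^\ast$. Generalized Bregman distances (for the operators $T=S=\partial f$ and $h=f\oplus f^\ast$): for $x,y\in\operatorname{dom}\partial f$, $$\mathcal{D}_{f\oplus f^\ast}^{\flat}(x,y):=\inf_{v\in\partial f(y)}\big(f(x)+f^\ast(v)-\langle x,v\rangle\big),\qquad \mathcal{D}_{f\oplus f^\ast}^{\sharp}(x,y):=\sup_{v\in\partial f(y)}\big(f(x)+f^\ast(v)-\langle x,v\rangle\big),$$ and both are $+\infty$ if $x\notin\operatorname{dom}\partial f$ or $y\notin\operatorname{dom}\partial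 f$. Bregman distances: $$\mathcal{D}_f^{\flat}(x,y):=f(x)-f(y)+\inf_{v\in\partial f(y)}\langle y-x,v\rangle,\qquad \mathcal{D}_f^{\sharp}(x,y):=f(x)-f(y)+\sup_{v\in\partial f(y)}\langle y-x,v\rangle,$$ with the convention that both equal $+\infty$ if $y\notin\operatorname{dom}\partial f$ or $x\notin\operatorname{dom} f$. *)

theory Defs
  imports "HOL-Analysis.Analysis"
begin

text \<open>
  Extended-real-valued functions have type \<open>'a \<Rightarrow> ereal\<close>; the topological dual of \<open>'a\<close> is the
  type \<open>'a \<Rightarrow>\<^sub>L real\<close> of bounded linear functionals.
\<close>

type_synonym 'a dual = "'a \<Rightarrow>\<^sub>L real"

definition domf :: "('a \<Rightarrow> ereal) \<Rightarrow> 'a set"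
  where "domf f = {x. f x < \<infinity>}"

text \<open>Properness includes that the value \<open>-\<infinity>\<close> is not attained.\<close>

definition proper_fun :: "('a \<Rightarrow> ereal) \<Rightarrow> bool"
  where "proper_fun f \<longleftrightarrow> (\<forall>x. f x > -\<infinity>) \<and> domf f \<noteq> {}"

definition lsc_fun :: "('a::topological_space \<Rightarrow> ereal) \<Rightarrow> bool"
  where "lsc_fun f \<longleftrightarrow> (\<forall>x. f x \<le> Liminf (nhds x) f)"

text \<open>
  The library's \<open>convex_on\<close> is for real-valued functions only. For functions that do not
  attain \<open>-\<infinity>\<close> the right-hand side below never has the form \<open>\<infinity> - \<infinity>\<close>; recall that
  \<open>0 * \<infinity> = 0\<close> in \<open>ereal\<close>, so that \<open>u = 0\<close> and \<open>u = 1\<close> give no constraint.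
\<close>

definition convex_fun :: "('a::real_vector \<Rightarrow> ereal) \<Rightarrow> bool"
  where "convex_fun f \<longleftrightarrow>
    (\<forall>x y. \<forall>u\<ge>0. \<forall>v\<ge>0. u + v = 1 \<longrightarrow>
      f (u *\<^sub>R x + v *\<^sub>R y) \<le> ereal u * f x + ereal v * f y)"

definition subdifferential :: "('a::real_normed_vector \<Rightarrow> ereal) \<Rightarrow> 'a \<Rightarrow> 'a dual set"
  where "subdifferential f x =
    {v. x \<in> domf f \<and> (\<forall>z. f x + ereal (blinfun_apply v (z - x)) \<le> f z)}"

text \<open>Domain of a set-valued operator.\<close>

definition dom_op :: "('a \<Rightarrow> 'b set) \<Rightarrow> 'a set"
  where "dom_op T = {x. T x \<noteq> {}}"

definition fenchel_conj :: "('a::real_normed_vector \<Rightarrow> ereal) \<Rightarrow> 'a dual \<Rightarrow> ereal"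
  where "fenchel_conj f v = (SUP x. ereal (blinfun_apply v x) - f x)"

definition fenchel_young :: "('a::real_normed_vector \<Rightarrow> ereal) \<Rightarrow> 'a \<times> 'a dual \<Rightarrow> ereal"
  where "fenchel_young f = (\<lambda>(x, v). f x + fenchel_conj f v)"

text \<open>
  Generalized Bregman distances induced by an operator \<open>T\<close> (in both roles, \<open>S = T\<close>) and a
  function \<open>h\<close> on \<open>X \<times> X\<^sup>*\<close>.
\<close>

definition gen_bregman_flat ::
    "('a::real_normed_vector \<Rightarrow> 'a dual set) \<Rightarrow> ('a \<times> 'a dual \<Rightarrow> ereal) \<Rightarrow> 'a \<Rightarrow> 'a \<Rightarrow> ereal"
  where "gen_bregman_flat T h x y =
    (if x \<in> dom_op T \<and> y \<in> dom_op T
     then (INF v\<in>T y. h (x, v) - ereal (blinfun_apply v x)) else \<infinity>)"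

definition gen_bregman_sharp ::
    "('a::real_normed_vector \<Rightarrow> 'a dual set) \<Rightarrow> ('a \<times> 'a dual \<Rightarrow> ereal) \<Rightarrow> 'a \<Rightarrow> 'a \<Rightarrow> ereal"
  where "gen_bregman_sharp T h x y =
    (if x \<in> dom_op T \<and> y \<in> dom_op T
     then (SUP v\<in>T y. h (x, v) - ereal (blinfun_apply v x)) else \<infinity>)"

definition bregman_flat :: "('a::real_normed_vector \<Rightarrow> ereal) \<Rightarrow> 'a \<Rightarrow> 'a \<Rightarrow> ereal"
  where "bregman_flat f x y =
    (if x \<in> domf f \<and> y \<in> dom_op (subdifferential f)
     then f x - f y + (INF v\<in>subdifferential f y. ereal (blinfun_apply v (y - x))) else \<infinity>)"

definition bregman_sharp :: "('a::real_normed_vector \<Rightarrow> ereal) \<Rightarrow> 'a \<Rightarrow> 'a \<Rightarrow> ereal"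
  where "bregman_sharp f x y =
    (if x \<in> domf f \<and> y \<in> dom_op (subdifferential f)
     then f x - f y + (SUP v\<in>subdifferential f y. ereal (blinfun_apply v (y - x))) else \<infinity>)"

end

theory Submission
  imports Defs
begin

text \<open>For \<open>v\<close> in the subdifferential at \<open>y\<close> the Fenchel-Young
  inequality is an equality, so the conjugate at \<open>v\<close> is \<open>v y - f y\<close>
  (\<open>fenchel_conj_subgradient\<close>). Hence the two kinds of distance have the same
  integrand, \<open>f x - f y + v (y - x)\<close> (\<open>fenchel_young_minus_pairing\<close>). Its
  first part is a finite constant and moves out of the infimum and the supremum. The domain
  conventions disagree only on the excluded set of pairs; elsewhere, when one kind is infinite by
  convention, so is the other.\<close>

lemma domf_finite:
  assumes "proper_fun f" and "x \<in> domf f"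
  obtains r where "f x = ereal r"
  using assms unfolding proper_fun_def domf_def by (cases "f x") auto

lemma subdifferential_imp_domf: "v \<in> subdifferential f x \<Longrightarrow> x \<in> domf f"
  by (simp add: subdifferential_def)

lemma dom_op_subdifferential_subset: "dom_op (subdifferential f) \<subseteq> domf f"
  using subdifferential_imp_domf unfolding dom_op_def by fastforce

text \<open>The subgradient inequality says exactly that the supremum defining the conjugate is
  attained at \<open>y\<close>.\<close>

lemma fenchel_conj_subgradient:
  assumes v: "v \<in> subdifferential f y" and y: "f y = ereal b"
  shows "fenchel_conj f v = ereal (blinfun_apply v y - b)"
  unfolding fenchel_conj_def
proof (rule antisym)
  show "(SUP x. ereal (blinfun_apply v x) - f x) \<le> ereal (blinfun_apply v y - b)"
  proof (rule SUP_least)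
    fix x
    have "ereal b + ereal (blinfun_apply v (x - y)) \<le> f x"
      using v y by (auto simp: subdifferential_def)
    \<comment> \<open>The finite lower bound rules out \<open>f x = -\<infinity>\<close>; for
      \<open>f x = \<infinity>\<close> the left side is \<open>-\<infinity>\<close>.\<close>
    then show "ereal (blinfun_apply v x) - f x \<le> ereal (blinfun_apply v y - b)"
      by (cases "f x") (auto simp: blinfun.diff_right)
  qed
  show "ereal (blinfun_apply v y - b) \<le> (SUP x. ereal (blinfun_apply v x) - f x)"
    by (rule SUP_upper2[of y]) (simp_all add: y)
qed

lemma fenchel_young_minus_pairing:
  assumes "proper_fun f" and "x \<in> domf f" and v: "v \<in> subdifferential f y"
  shows "fenchel_young f (x, v) - ereal (blinfun_apply v x)
    = f x - f y + ereal (blinfun_apply v (y - x))"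
proof -
  obtain a where "f x = ereal a"
    using domf_finite assms(1,2) .
  moreover obtain b where b: "f y = ereal b"
    using domf_finite assms(1) subdifferential_imp_domf[OF v] .
  ultimately show ?thesis
    by (simp add: fenchel_young_def fenchel_conj_subgradient[OF v b] blinfun.diff_right)
qed

text \<open>Translation by a finite constant is monotone and continuous from the right at the
  infimum, so it commutes with infima of nonempty families, even when the infimum is
  \<open>-\<infinity>\<close>.\<close>

lemma ereal_INF_const_add:
  fixes g :: "'i \<Rightarrow> ereal"
  assumes "I \<noteq> {}" and "\<bar>c\<bar> \<noteq> \<infinity>"
  shows "(INF i\<in>I. c + g i) = c + (INF i\<in>I. g i)"
proof -
  have "((\<lambda>z. z + c) \<longlongrightarrow> Inf (g ` I) + c) (at_right (Inf (g ` I)))"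
    using assms(2) by (intro tendsto_add_left_ereal tendsto_ident_at)
  then have "continuous (at_right (Inf (g ` I))) (\<lambda>z. z + c)"
    by (simp add: continuous_within)
  moreover have "mono (\<lambda>z. z + c)"
    by (simp add: mono_def add_right_mono)
  ultimately show ?thesis
    using continuous_at_Inf_mono[of "\<lambda>z. z + c" "g ` I"] assms(1)
    by (simp add: image_comp add.commute)
qed

theorem proposition2p2:
  fixes f :: "'a::banach \<Rightarrow> ereal"
  assumes "proper_fun f" and "lsc_fun f" and "convex_fun f"
  shows "\<forall>x y. (x, y) \<notin> (domf f - dom_op (subdifferential f)) \<times> dom_op (subdifferential f) \<longrightarrow>
    gen_bregman_flat (subdifferential f) (fenchel_young f) x y = bregman_flat f x y \<and>
    gen_bregman_sharp (subdifferential f) (fenchel_young f) x y = bregman_sharp f x y"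
proof (intro allI impI)
  fix x y
  let ?D = "dom_op (subdifferential f)"
  assume xy: "(x, y) \<notin> (domf f - ?D) \<times> ?D"
  show "gen_bregman_flat (subdifferential f) (fenchel_young f) x y = bregman_flat f x y \<and>
    gen_bregman_sharp (subdifferential f) (fenchel_young f) x y = bregman_sharp f x y"
  proof (cases "x \<in> domf f \<and> y \<in> ?D")
    case True
    \<comment> \<open>The exclusion of the pair is used here: with \<open>y\<close> in
      \<open>?D\<close>, a point \<open>x\<close> of \<open>domf f\<close> must lie in
      \<open>?D\<close>, so both guards hold.\<close>
    then have x: "x \<in> domf f" "x \<in> ?D" and y: "y \<in> domf f" "y \<in> ?D"
      using xy dom_op_subdifferential_subset by auto
    have ne: "subdifferential f y \<noteq> {}"
      using y(2) by (simp add: dom_op_def)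
    obtain a b where "f x = ereal a" and "f y = ereal b"
      using domf_finite[OF assms(1)] x(1) y(1) by metis
    \<comment> \<open>The infimum rule asks for a finite constant, the supremum rule for one other
      than \<open>-\<infinity>\<close>.\<close>
    then have fin: "\<bar>f x - f y\<bar> \<noteq> \<infinity>" "f x - f y \<noteq> -\<infinity>"
      by simp_all
    show ?thesis
      using x y
      by (simp add: gen_bregman_flat_def gen_bregman_sharp_def bregman_flat_def bregman_sharp_def
          fenchel_young_minus_pairing[OF assms(1)] ereal_INF_const_add[OF ne fin(1)]
          SUP_ereal_add_right[OF ne fin(2)])
  next
    case False
    \<comment> \<open>As \<open>?D\<close> lies in \<open>domf f\<close>, the guards of both kinds
      fail, and all four distances are \<open>\<infinity>\<close>.\<close>
    then show ?thesis
      using dom_op_subdifferential_subset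
      by (auto simp: gen_bregman_flat_def gen_bregman_sharp_def bregman_flat_def bregman_sharp_def)
  qed
qed

end
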